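(* Let $d\ge 1$ and $r$ be integers, and let $\Pi_1,\dots,\Pi_{d^2}$ be an $r$-SIC in $\mathbb{C}^d$. Then for all $j,k\in\{1,\dots,d^2\}$, $$\operatorname{Tr}(\Pi_j\Pi_k)=\frac{rd(d-r)}{d^2-1}\,\delta_{jk}+\frac{r(rd-1)}{d^2-1}.$$ Furthermore, the operators $\Pi_1,\dots,\Pi_{d^2}$ form a basis of the space $\mathcal{L}(\mathbb{C}^d)$ of linear operators on $\mathbb{C}^d$, and $$\sum_{j=1}^{d^2}\Pi_j = rd\,I.$$
   Context: A Hermitian projector is an operator $\Pi\in\mathcal{L}(\mathbb{C}^d)$ with $\Pi^2=\Pi=\Pi^\dagger$. An $r$-SIC is a set of $d^2$ distinct rank-$r$ Hermitian projectors $\Pi_1,\dots,\Pi_{d^2}$ on $\mathbb{C}^d$ such that there is a constant $\alpha$ with $\operatorname{Tr}(\Pi_j\Pi_k)=\alpha$ for all $j\neq k$. $\delta_{jk}$ is the Kronecker delta.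
   Formalization: The trace formula is asserted only for d ≥ 2, since for d = 1 its denominator d²−1 is zero; the basis claim excludes d = 1, r = 0, where the single projector is 0 and is not a basis. The sum identity holds without restriction. *)

theory Defs
  imports "HOL-Analysis.Analysis"
begin

text \<open>
  Operators on $\mathbb{C}^d$ are square complex matrices, with $d$ the cardinality of the index
  type. The library's \<open>*s\<close> on \<open>complex ^ 'n ^ 'n\<close> takes its scalars in \<open>complex ^ 'n\<close>, and
  \<open>*\<^sub>R\<close> takes real scalars, so the complex vector space structure is introduced here.
\<close>

definition cmat_scale :: "complex \<Rightarrow> complex ^ 'n ^ 'm \<Rightarrow> complex ^ 'n ^ 'm"  (infixr \<open>*\<^sub>M\<close> 75)
  where "c *\<^sub>M A = (\<chi> i j. c * A $ i $ j)"

global_interpretation cmat: vector_space "cmat_scale :: complex \<Rightarrow> complex ^ 'n ^ 'm \<Rightarrow> _"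
  by unfold_locales (simp_all add: cmat_scale_def vec_eq_iff algebra_simps)

definition conj_transpose :: "complex ^ 'n ^ 'm \<Rightarrow> complex ^ 'm ^ 'n"
  where "conj_transpose A = (\<chi> i j. cnj (A $ j $ i))"

definition hermitian_projector :: "complex ^ 'n ^ 'n \<Rightarrow> bool"
  where "hermitian_projector P \<longleftrightarrow> P ** P = P \<and> conj_transpose P = P"

text \<open>Only the values of \<open>P\<close> on $\{1,\dots,d^2\}$ are constrained.\<close>

definition r_SIC :: "nat \<Rightarrow> (nat \<Rightarrow> complex ^ 'n ^ 'n) \<Rightarrow> bool"
  where "r_SIC r P \<longleftrightarrow>
    inj_on P {1..CARD('n)\<^sup>2} \<and>
    (\<forall>j\<in>{1..CARD('n)\<^sup>2}. hermitian_projector (P j) \<and> rank (P j) = r) \<and>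
    (\<exists>\<alpha>. \<forall>j\<in>{1..CARD('n)\<^sup>2}. \<forall>k\<in>{1..CARD('n)\<^sup>2}. j \<noteq> k \<longrightarrow> trace (P j ** P k) = \<alpha>)"

end

theory Submission
  imports Defs
begin

text \<open>
  The Gram matrix of the projectors for the trace form has $r$ on the diagonal and a constant
  $\alpha$ elsewhere, where $0 \le \alpha < r$: the trace of a product of two Hermitian projectors is
  the squared Hilbert--Schmidt norm of that product, and $2(r - \alpha)$ is the squared norm of the
  difference of two distinct projectors. Such a Gram matrix is nonsingular, so the $d^2$ projectors
  are a basis. Against every element of this basis, their sum pairs like a fixed multiple of the
  identity, hence is that multiple of the identity; taking traces determines the multiple, and
  comparing the two pairings determines $\alpha$.

  For $d = 1$ the off-diagonal condition is vacuous and $\alpha = 0$ is a legitimate choice, so that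
  only the zero projector needs a separate treatment.
\<close>

text \<open>This is a rank factorization A = C R: the rows of R are the vectors of \<open>B\<close>,
  and the rows of C are the coordinates of the rows of A in \<open>B\<close>. Idempotence makes
  every diagonal entry of R C equal to 1, and C R has the same trace as R C, namely
  \<open>card B\<close>.\<close>

lemma trace_idempotent_eq_rank:
  fixes A :: "'a::field ^ 'n ^ 'n"
  assumes "A ** A = A"
  shows "trace A = of_nat (rank A)"
proof -
  obtain B where B: "B \<subseteq> rows A" "vec.independent B" "rows A \<subseteq> vec.span B" "card B = vec.dim (rows A)"
    using vec.basis_exists by blast
  have fin: "finite B"
    using B(2) by (rule vec.finiteI_independent)
  let ?\<phi> = "vec.representation B"
  have row_span: "A $ i \<in> vec.span B" for i
    using B(3) by (auto simp: rows_def row_def vec_eq_iff)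
  have coord: "(\<Sum>i\<in>UNIV. ?\<phi> (A $ i) b * b $ i) = 1" if b: "b \<in> B" for b
  proof -
    \<comment> \<open>The basis was chosen among the rows of A. Hence b is also a row of
      \<open>A ** A\<close>, that is, a combination of the rows of A whose coefficients are the
      entries of b; comparing coordinates at b gives the claim.\<close>
    obtain m where m: "b = A $ m"
      using B(1) b by (auto simp: rows_def row_def vec_eq_iff)
    have "(A ** A) $ m = (\<Sum>i\<in>UNIV. b $ i *s A $ i)"
      by (simp add: vec_eq_iff matrix_matrix_mult_def m)
    then have "b = (\<Sum>i\<in>UNIV. b $ i *s A $ i)"
      using assms m by simp
    then have "?\<phi> b b = ?\<phi> (\<Sum>i\<in>UNIV. b $ i *s A $ i) b"
      by simp
    also have "\<dots> = (\<Sum>i\<in>UNIV. b $ i * ?\<phi> (A $ i) b)"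
      using B(2) row_span by (simp add: vec.representation_sum vec.representation_scale vec.span_scale)
    finally show ?thesis
      using B(2) b by (simp add: vec.representation_basis mult.commute)
  qed
  have "A $ i $ i = (\<Sum>b\<in>B. ?\<phi> (A $ i) b * b $ i)" for i
    using arg_cong[OF vec.sum_representation_eq[OF B(2) row_span fin order_refl], of "\<lambda>v. v $ i" i]
    by simp
  then have "trace A = (\<Sum>i\<in>UNIV. \<Sum>b\<in>B. ?\<phi> (A $ i) b * b $ i)"
    by (simp add: trace_def)
  also have "\<dots> = (\<Sum>b\<in>B. \<Sum>i\<in>UNIV. ?\<phi> (A $ i) b * b $ i)"
    by (rule sum.swap)
  also have "\<dots> = of_nat (card B)"
    by (simp add: coord)
  finally show ?thesis
    by (simp add: B(4) row_rank_def_gen)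
qed

section \<open>Linearity of the trace and of the matrix operations\<close>

lemma trace_sum: "trace (\<Sum>j\<in>I. A j) = (\<Sum>j\<in>I. trace (A j))"
  unfolding trace_def sum_component by (rule sum.swap)

lemma trace_cmat_scale: "trace (c *\<^sub>M A) = c * trace A"
  by (simp add: trace_def cmat_scale_def sum_distrib_left)

lemma cmat_scale_mult_left: "(c *\<^sub>M A) ** B = c *\<^sub>M (A ** B)"
  by (simp add: vec_eq_iff cmat_scale_def matrix_matrix_mult_def sum_distrib_left mult.assoc)

lemma matrix_sum_rdistrib: "(\<Sum>j\<in>I. A j) ** B = (\<Sum>j\<in>I. A j ** B)"
proof -
  have "(\<Sum>k\<in>UNIV. \<Sum>j\<in>I. A j $ x $ k * B $ k $ y) = (\<Sum>j\<in>I. \<Sum>k\<in>UNIV. A j $ x $ k * B $ k $ y)" for x y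
    by (rule sum.swap)
  then show ?thesis
    by (simp add: vec_eq_iff matrix_matrix_mult_def sum_distrib_right)
qed

lemma matrix_add_rdistrib: "(A + B) ** C = A ** C + B ** C"
  by (simp add: vec_eq_iff matrix_matrix_mult_def distrib_right sum.distrib)

lemma matrix_diff_rdistrib: "(A - B) ** C = A ** C - B ** C"
  for A B :: "'a::ring_1 ^ 'n ^ 'm"
  by (simp add: vec_eq_iff matrix_matrix_mult_def left_diff_distrib sum_subtractf)

lemma matrix_diff_ldistrib: "A ** (B - C) = A ** B - A ** C"
  for A :: "'a::ring_1 ^ 'n ^ 'm"
  by (simp add: vec_eq_iff matrix_matrix_mult_def right_diff_distrib sum_subtractf)

lemma conj_transpose_mult: "conj_transpose (A ** B) = conj_transpose B ** conj_transpose A"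
  by (simp add: vec_eq_iff conj_transpose_def matrix_matrix_mult_def mult.commute)

lemma conj_transpose_diff: "conj_transpose (A - B) = conj_transpose A - conj_transpose B"
  by (simp add: vec_eq_iff conj_transpose_def)

section \<open>Positivity of the Hilbert--Schmidt form and its values on Hermitian
  projectors\<close>

lemma trace_mult_conj_transpose:
  "trace (A ** conj_transpose A) = of_real (\<Sum>i\<in>UNIV. \<Sum>j\<in>UNIV. (cmod (A $ i $ j))\<^sup>2)"
  unfolding of_real_sum complex_norm_square
  by (simp add: trace_def matrix_matrix_mult_def conj_transpose_def)

text \<open>The trace is a complex number; naming a real value for it delivers its reality and its
  sign together.\<close>

lemma trace_mult_conj_transpose_nonneg:
  obtains x where "x \<ge> 0" "trace (A ** conj_transpose A) = of_real x"
  by (rule that[OF _ trace_mult_conj_transpose]) (simp add: sum_nonneg)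

lemma trace_mult_conj_transpose_eq_0_iff: "trace (A ** conj_transpose A) = 0 \<longleftrightarrow> A = 0"
  unfolding trace_mult_conj_transpose of_real_eq_0_iff
  by (simp add: sum_nonneg_eq_0_iff sum_nonneg vec_eq_iff)

lemma hermitian_projector_trace:
  assumes "hermitian_projector P"
  shows "trace P = of_nat (rank P)"
  using assms by (simp add: hermitian_projector_def trace_idempotent_eq_rank)

text \<open>The product of P Q with its adjoint is P Q Q P = P Q P; cyclicity of the trace brings
  the last P to the front, where it is absorbed.\<close>

lemma hermitian_projector_trace_mult_nonneg:
  assumes "hermitian_projector P" "hermitian_projector Q"
  obtains x where "x \<ge> 0" "trace (P ** Q) = of_real x"
proof -
  have "trace ((P ** Q) ** conj_transpose (P ** Q)) = trace (P ** (Q ** Q) ** P)"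
    using assms unfolding conj_transpose_mult hermitian_projector_def by (metis matrix_mul_assoc)
  also have "\<dots> = trace (P ** (P ** Q))"
    using assms by (simp add: hermitian_projector_def trace_mul_sym[of "P ** Q"])
  also have "\<dots> = trace (P ** Q)"
    using assms by (simp add: matrix_mul_assoc hermitian_projector_def)
  finally show ?thesis
    using that trace_mult_conj_transpose_nonneg by metis
qed

lemma hermitian_projector_trace_mult_less_rank:
  assumes "hermitian_projector P" "hermitian_projector Q" "P \<noteq> Q"
    and rank: "rank P = r" "rank Q = r"
    and x: "trace (P ** Q) = of_real x"
  shows "x < r"
proof -
  have "conj_transpose (P - Q) = P - Q"
    using assms(1,2) by (simp add: conj_transpose_diff hermitian_projector_def)
  \<comment> \<open>Idempotence turns the two square terms into the common rank r, and by cyclicity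
    both cross terms equal x.\<close>
  moreover have "trace ((P - Q) ** (P - Q)) = of_real (2 * (r - x))"
    using assms(1,2) x rank trace_mul_sym[of Q P]
    by (simp add: matrix_diff_rdistrib matrix_diff_ldistrib trace_sub hermitian_projector_trace
        hermitian_projector_def[THEN iffD1])
  ultimately have eq: "trace ((P - Q) ** conj_transpose (P - Q)) = of_real (2 * (r - x))"
    by simp
  obtain y where y: "y \<ge> 0" "trace ((P - Q) ** conj_transpose (P - Q)) = of_real y"
    by (rule trace_mult_conj_transpose_nonneg)
  have "y = 2 * (r - x)"
    using eq y(2) by (metis of_real_eq_iff)
  moreover have "y \<noteq> 0"
    using y(2) assms(3) trace_mult_conj_transpose_eq_0_iff[of "P - Q"] by auto
  ultimately show ?thesis
    using y(1) by simp
qed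

section \<open>Nondegeneracy, dimension and linear independence\<close>

lemma trace_form_nondegenerate:
  fixes A :: "complex ^ 'n ^ 'n"
  assumes "cmat.span S = UNIV" "\<And>B. B \<in> S \<Longrightarrow> trace (B ** A) = 0"
  shows "A = 0"
proof -
  have "cmat.subspace {B. trace (B ** A) = 0}"
    by (simp add: cmat.subspace_def trace_add cmat_scale_mult_left trace_cmat_scale
        matrix_add_rdistrib trace_0[unfolded mat_0])
  then have "cmat.span S \<subseteq> {B. trace (B ** A) = 0}"
    using assms(2) by (intro cmat.span_minimal) auto
  \<comment> \<open>The form is bilinear, without conjugation, so testing A against its adjoint
    produces a squared norm.\<close>
  then have "trace (conj_transpose A ** A) = 0"
    using assms(1) by auto
  then show ?thesis
    by (simp add: trace_mul_sym[of "conj_transpose A"] trace_mult_conj_transpose_eq_0_iff)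
qed

lemma cmat_independent_span_UNIV:
  fixes S :: "(complex ^ 'n ^ 'm) set"
  assumes indep: "cmat.independent S" and card: "card S = CARD('m) * CARD('n)"
  shows "cmat.span S = UNIV"
proof (rule ccontr)
  assume "cmat.span S \<noteq> UNIV"
  then obtain A where A: "A \<notin> cmat.span S"
    by auto
  \<comment> \<open>These are the matrix units. They span the space, so an independent set cannot
    outnumber them, as \<open>insert A S\<close> would.\<close>
  define E :: "'m \<times> 'n \<Rightarrow> complex ^ 'n ^ 'm" where "E = (\<lambda>(i, j). axis i (axis j 1))"
  have "c * E p $ x $ y = (if p = (x, y) then c else 0)" for c p x y
    by (auto simp: E_def axis_def split: prod.splits)
  then have "B = (\<Sum>p\<in>UNIV. B $ fst p $ snd p *\<^sub>M E p)" for B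
    by (simp add: vec_eq_iff cmat_scale_def)
  then have span: "B \<in> cmat.span (range E)" for B
    by (metis (no_types, lifting) cmat.span_base cmat.span_scale cmat.span_sum rangeI)
  have "cmat.independent (insert A S)"
    using A indep by (simp add: cmat.independent_insert)
  then have "card (insert A S) \<le> card (range E)"
    using cmat.independent_span_bound[of "range E" "insert A S"] span by auto
  also have "\<dots> \<le> CARD('m) * CARD('n)"
    using card_image_le[of UNIV E] by (simp add: card_prod)
  finally have "card (insert A S) \<le> card S"
    by (simp add: card)
  \<comment> \<open>An infinite set has cardinality 0 by convention, whereas the product of the two
    dimensions is positive.\<close>
  moreover have "finite S"
    using card card.infinite by fastforce
  ultimately show False
    using A cmat.span_base by (fastforce simp: card_insert_if split: if_splits)
qed

text \<open>The Gram matrix is (a - b) I + b J with J the all-ones matrix. Its possible eigenvalues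
  a - b and a - b + |I| b are both positive; the first controls each coefficient, the second their
  sum.\<close>

lemma independent_if_equiangular:
  fixes P :: "'i \<Rightarrow> complex ^ 'n ^ 'n"
  assumes "finite I" and inj: "inj_on P I"
    and gram: "\<And>j k. j \<in> I \<Longrightarrow> k \<in> I \<Longrightarrow> trace (P j ** P k) = of_real (if j = k then a else b)"
    and ab: "0 \<le> b" "b < a"
  shows "cmat.independent (P ` I)"
proof (rule cmat.independent_if_scalars_zero)
  show "finite (P ` I)"
    using \<open>finite I\<close> by simp
  fix f x
  assume "(\<Sum>x\<in>P ` I. f x *\<^sub>M x) = 0" and x: "x \<in> P ` I"
  then have zero: "(\<Sum>j\<in>I. f (P j) *\<^sub>M P j) = 0"
    using inj by (simp add: sum.reindex)
  define c where "c j = f (P j)" for j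
  have pairing: "(a - b) * c k + b * (\<Sum>j\<in>I. c j) = 0" if k: "k \<in> I" for k
  proof -
    have "0 = trace ((\<Sum>j\<in>I. c j *\<^sub>M P j) ** P k)"
      using zero by (simp add: c_def trace_def)
    also have "\<dots> = (\<Sum>j\<in>I. c j * trace (P j ** P k))"
      by (simp add: matrix_sum_rdistrib trace_sum cmat_scale_mult_left trace_cmat_scale)
    also have "\<dots> = (\<Sum>j\<in>I. (if j = k then (a - b) * c j else 0) + b * c j)"
      using k by (intro sum.cong) (auto simp: gram algebra_simps)
    also have "\<dots> = (a - b) * c k + b * (\<Sum>j\<in>I. c j)"
      using k \<open>finite I\<close> by (simp add: sum.distrib sum_distrib_left)
    finally show ?thesis
      by simp
  qed
  \<comment> \<open>Adding the pairings over all k leaves an equation in the total of the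
    coefficients alone.\<close>
  have "0 = (\<Sum>k\<in>I. (a - b) * c k + b * (\<Sum>j\<in>I. c j))"
    using pairing by (intro sum.neutral[symmetric] ballI)
  also have "\<dots> = of_real (a - b + card I * b) * (\<Sum>j\<in>I. c j)"
    unfolding sum.distrib sum_distrib_left[symmetric] by (simp add: algebra_simps)
  finally have "of_real (a - b + card I * b) * (\<Sum>j\<in>I. c j) = 0"
    by simp
  moreover have "a - b + card I * b > 0"
    using ab by (simp add: add_pos_nonneg)
  ultimately have "(\<Sum>j\<in>I. c j) = 0"
    by (metis less_irrefl mult_eq_0_iff of_real_eq_0_iff)
  moreover obtain k where k: "k \<in> I" "x = P k"
    using x by auto
  ultimately have "of_real (a - b) * c k = 0"
    using pairing[OF k(1)] by simp
  then have "c k = 0"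
    using ab(2) by (metis diff_gt_0_iff_gt less_irrefl mult_eq_0_iff of_real_eq_0_iff)
  then show "f x = 0"
    by (simp add: c_def k(2))
qed

section \<open>The Gram matrix of an r-SIC and the main result\<close>

lemma r_SIC_gram:
  fixes P :: "nat \<Rightarrow> complex ^ 'n ^ 'n"
  assumes sic: "r_SIC r P" and nontrivial: "\<not> (CARD('n) = 1 \<and> r = 0)"
  obtains \<alpha> :: real where "0 \<le> \<alpha>" "\<alpha> < r"
    "\<And>j k. j \<in> {1..CARD('n)\<^sup>2} \<Longrightarrow> k \<in> {1..CARD('n)\<^sup>2} \<Longrightarrow>
      trace (P j ** P k) = of_real (if j = k then real r else \<alpha>)"
proof -
  let ?I = "{1..CARD('n)\<^sup>2}"
  have proj: "hermitian_projector (P j)" "rank (P j) = r" if "j \<in> ?I" for j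
    using sic that by (auto simp: r_SIC_def)
  have diag: "trace (P j ** P j) = of_real (real r)" if "j \<in> ?I" for j
    using proj[OF that] hermitian_projector_trace[of "P j"] by (simp add: hermitian_projector_def)
  show ?thesis
  proof (cases "CARD('n) = 1")
    case True
    then show ?thesis
      \<comment> \<open>The index set is {1}, so there is no off-diagonal entry to match; 0 < r
        comes from \<open>nontrivial\<close>.\<close>
      using that[of 0] nontrivial diag by simp
  next
    case False
    then have "CARD('n) \<ge> 2"
      using zero_less_card_finite[where 'a = 'n] by linarith
    \<comment> \<open>One off-diagonal pair is enough to locate the common value, and it exists
      because the number of indices is at least 4.\<close>
    then have two: "1 \<in> ?I" "2 \<in> ?I"
      using power_mono[of 2 "CARD('n)" 2] by auto
    obtain a where a: "\<forall>j\<in>?I. \<forall>k\<in>?I. j \<noteq> k \<longrightarrow> trace (P j ** P k) = a"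
      using sic unfolding r_SIC_def by (elim conjE exE)
    obtain \<alpha> where \<alpha>: "\<alpha> \<ge> 0" "trace (P 1 ** P 2) = of_real \<alpha>"
      using hermitian_projector_trace_mult_nonneg proj(1) two by blast
    have "inj_on P ?I"
      using sic by (simp add: r_SIC_def)
    then have "P 1 \<noteq> P 2"
      using two by (simp add: inj_on_eq_iff)
    then have "\<alpha> < r"
      by (rule hermitian_projector_trace_mult_less_rank
          [OF proj(1)[OF two(1)] proj(1)[OF two(2)] _ proj(2)[OF two(1)] proj(2)[OF two(2)] \<alpha>(2)])
    moreover have "a = of_real \<alpha>"
      using bspec[OF bspec[OF a two(1)] two(2)] \<alpha>(2) by simp
    ultimately show ?thesis
      using that[of \<alpha>] \<alpha>(1) a diag by simp
  qed
qed

text \<open>The formula divides by d^2 - 1: for d = 1 the convention x / 0 = 0 would make its right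
  side 0, although the trace is 1 when r = 1. For d = 1 and r = 0 the only projector is 0, which is
  not a basis.\<close>

theorem theorem1p7:
  fixes P :: "nat \<Rightarrow> complex ^ 'n ^ 'n" and d r :: nat
  assumes "d = CARD('n)"
    and "r_SIC r P"
  shows "(d \<noteq> 1 \<longrightarrow> (\<forall>j\<in>{1..d\<^sup>2}. \<forall>k\<in>{1..d\<^sup>2}.
            trace (P j ** P k) =
              of_nat r * of_nat d * (of_nat d - of_nat r) / ((of_nat d)\<^sup>2 - 1) * (if j = k then 1 else 0)
              + of_nat r * (of_nat r * of_nat d - 1) / ((of_nat d)\<^sup>2 - 1)))
    \<and> (\<not> (d = 1 \<and> r = 0) \<longrightarrow>
            cmat.independent (P ` {1..d\<^sup>2}) \<and> cmat.span (P ` {1..d\<^sup>2}) = UNIV)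
    \<and> (\<Sum>j = 1..d\<^sup>2. P j) = (of_nat r * of_nat d) *\<^sub>M mat 1"
proof (cases "d = 1 \<and> r = 0")
  case True
  then have "hermitian_projector (P 1)" "rank (P 1) = 0"
    using assms by (auto simp: r_SIC_def)
  then have "trace (P 1 ** conj_transpose (P 1)) = 0"
    using hermitian_projector_trace[of "P 1"] by (simp add: hermitian_projector_def)
  then have "P 1 = 0"
    by (simp add: trace_mult_conj_transpose_eq_0_iff)
  then show ?thesis
    using True by simp
next
  case False
  let ?I = "{1..d\<^sup>2}"
  obtain \<alpha> where \<alpha>: "0 \<le> \<alpha>" "\<alpha> < real r"
    and gram: "\<And>j k. j \<in> ?I \<Longrightarrow> k \<in> ?I \<Longrightarrow> trace (P j ** P k) = of_real (if j = k then real r else \<alpha>)"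
    using r_SIC_gram assms False by metis
  have inj: "inj_on P ?I" and tr: "\<And>j. j \<in> ?I \<Longrightarrow> trace (P j) = of_nat r"
    using assms by (auto simp: r_SIC_def hermitian_projector_trace)
  have indep: "cmat.independent (P ` ?I)"
    using independent_if_equiangular[OF _ inj gram \<alpha>] by simp
  have span: "cmat.span (P ` ?I) = UNIV"
    by (rule cmat_independent_span_UNIV[OF indep])
      (use card_image[OF inj] in \<open>simp add: assms(1) power2_eq_square\<close>)
  define T where "T = (\<Sum>j\<in>?I. P j)"
  \<comment> \<open>The numerator is the pairing of \<open>T\<close> with any \<open>P k\<close>,
    and the denominator is the pairing of the identity with it.\<close>
  define c :: real where "c = (r + ((real d)\<^sup>2 - 1) * \<alpha>) / r"
  have r: "r > 0" and d: "d > 0"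
    using \<alpha> assms(1) by auto
  have "T - of_real c *\<^sub>M mat 1 = 0"
  proof (rule trace_form_nondegenerate[OF span])
    fix B
    assume "B \<in> P ` ?I"
    then obtain k where k: "k \<in> ?I" "B = P k"
      by auto
    have "trace (T ** P k) = (\<Sum>j\<in>?I. of_real (if j = k then real r else \<alpha>))"
      unfolding T_def matrix_sum_rdistrib trace_sum using k by (intro sum.cong) (simp_all add: gram)
    also have "\<dots> = of_real (\<Sum>j\<in>?I. (if j = k then real r - \<alpha> else 0) + \<alpha>)"
      unfolding of_real_sum by (intro sum.cong) auto
    also have "\<dots> = of_real (r - \<alpha> + d\<^sup>2 * \<alpha>)"
      using k by (simp add: sum.distrib)
    also have "r - \<alpha> + d\<^sup>2 * \<alpha> = c * r"
      using r d by (simp add: c_def field_simps)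
    finally show "trace (B ** (T - of_real c *\<^sub>M mat 1)) = 0"
      by (simp add: k trace_mul_sym[of "P k"] matrix_diff_rdistrib trace_sub cmat_scale_mult_left
          trace_cmat_scale tr[OF k(1)])
  qed
  then have T: "T = of_real c *\<^sub>M mat 1"
    by simp
  \<comment> \<open>Computing the trace of \<open>T\<close> a second time, from its d^2 summands of
    trace r, determines \<open>c\<close>.\<close>
  have "of_real (c * d) = trace T"
    by (simp add: T trace_cmat_scale trace_I assms(1))
  also have "\<dots> = of_real (d * r * d)"
    by (simp add: T_def trace_sum tr power2_eq_square)
  finally have "c * d = d * r * d"
    by (metis of_real_eq_iff)
  then have c: "c = r * d"
    using d by simp
  have gram_formula: "trace (P j ** P k) =
      of_nat r * of_nat d * (of_nat d - of_nat r) / ((of_nat d)\<^sup>2 - 1) * (if j = k then 1 else 0)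
      + of_nat r * (of_nat r * of_nat d - 1) / ((of_nat d)\<^sup>2 - 1)"
    if "d \<noteq> 1" and jk: "j \<in> ?I" "k \<in> ?I" for j k
  proof -
    have d1: "(real d)\<^sup>2 - 1 > 0"
      using that(1) d by simp
    \<comment> \<open>Equating the definition of \<open>c\<close> with its value r d gives a linear
      equation for \<alpha>.\<close>
    have "r + ((real d)\<^sup>2 - 1) * \<alpha> = r * (r * d)"
      using c r d by (simp add: c_def field_simps)
    then have off_diag: "\<alpha> = r * (real r * d - 1) / ((real d)\<^sup>2 - 1)"
      using d1 by (simp add: field_simps)
    \<comment> \<open>This identity shows that the diagonal value r also has the claimed form: the
      coefficient of the Kronecker delta is r - \<alpha>.\<close>
    have "r * d * (real d - r) + r * (real r * d - 1) = r * ((real d)\<^sup>2 - 1)"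
      by (simp add: algebra_simps power2_eq_square)
    then have "real r = r * d * (real d - r) / ((real d)\<^sup>2 - 1) + r * (real r * d - 1) / ((real d)\<^sup>2 - 1)"
      using d1 by (simp add: add_divide_distrib[symmetric])
    with off_diag have "(if j = k then real r else \<alpha>) =
        r * d * (real d - r) / ((real d)\<^sup>2 - 1) * (if j = k then 1 else 0)
        + r * (real r * d - 1) / ((real d)\<^sup>2 - 1)"
      by (cases "j = k") auto
    then have "trace (P j ** P k) = of_real (r * d * (real d - r) / ((real d)\<^sup>2 - 1) * (if j = k then 1 else 0)
        + r * (real r * d - 1) / ((real d)\<^sup>2 - 1))"
      by (simp only: gram[OF jk])
    then show ?thesis
      by (cases "j = k") simp_all
  qed
  show ?thesis
    using gram_formula indep span T by (simp add: T_def c)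
qed

end
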